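(* Let $\Pi$ be a projective plane and let $M(t)=(m_{ij}(t))_{1\le i,j\le 4}$ be a $4\times4$ submatrix, with identity valuation pattern, of a rank-$\le3$ lift of $I(\Pi)$, with expansions $$m_{ii}(t)=t a_i+O(t^2)\quad(a_i\in k^* ),\qquad m_{ij}(t)=u_{ij}+t w_{ij}+O(t^2)\quad (i\ne j,\ u_{ij}\in k^*,\ w_{ij}\in k).$$ Then $\det M(t)=0$, and therefore $$\Theta_4(U)=0\qquad\text{and}\qquad\Psi_4(U,A,W)=0.$$
   Context: A projective plane $\Pi$ is a finite incidence structure with point set $P$ and line set $L$ in which any two distinct points lie on a unique line, any two distinct lines meet in a unique point, there exist four points no three collinear, and, for some $q$ (the order), every line contains $q+1$ points. Its incidence matrix $I(\Pi)\in\{0,1\}^{P\times L}$ has entry $1$ at $(p,\ell)$ iff $p\in\ell$. $K$ is a discretely valued field with valuation $\mathrm{val}$, uniformizer $t$ of valuation $1$ and residue field $k$ identified with a coefficient subfield of the valuation ring (e.g. $K=k((t))$); $O(t^2)$ denotes an element of valuation at least $2$. A rank-$\le3$ lift of $I(\Pi)$ is a matrix over $K$ of rank at most $3$ whose entrywise valuation is $I(\Pi)$. A $4\times4$ matrix has identity valuation pattern if its diagonal entries have valuation $1$ and its off-diagonal entries have valuation $0$. $D_4\subset S_4$ is the set of derangements, $A=(a_1,\dots,a_4)$, $U=(u_{ij})_{i\ne j}$, $W=(w_{ij})_{i\ne j}$. Put $\Theta_4(U)=\sum_{\sigma\in D_4}\mathrm{sgn}(\sigma)\prod_{r=1}^4u_{r,\sigma(r)}$;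 for $\{j,k,\ell\}=\{1,2,3,4\}\setminus\{i\}$ put $D_i(U)=u_{jk}u_{k\ell}u_{\ell j}+u_{j\ell}u_{\ell k}u_{kj}$; and $$\Psi_4(U,A,W)=\sum_{i=1}^4 a_iD_i(U)+\sum_{\sigma\in D_4}\mathrm{sgn}(\sigma)\Bigl(\prod_{r=1}^4u_{r,\sigma(r)}\Bigr)\Bigl(\sum_{r=1}^4\frac{w_{r,\sigma(r)}}{u_{r,\sigma(r)}}\Bigr).$$ *)

theory Defs
  imports "HOL-Analysis.Analysis" "HOL-Library.Extended"
begin

section \<open>Projective planes\<close>

text \<open>Points and lines are the elements of two finite types, related by an incidence relation.\<close>

locale projective_plane =
  fixes inc :: "'p::finite \<Rightarrow> 'l::finite \<Rightarrow> bool"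
  assumes ex1_line: "p \<noteq> p' \<Longrightarrow> \<exists>!l. inc p l \<and> inc p' l"
    and ex1_point: "l \<noteq> l' \<Longrightarrow> \<exists>!p. inc p l \<and> inc p l'"
    and quadrangle:
      "\<exists>S. card S = 4 \<and> (\<forall>T\<subseteq>S. card T = 3 \<longrightarrow> \<not> (\<exists>l. \<forall>p\<in>T. inc p l))"
    and ex_order: "\<exists>q. \<forall>l. card {p. inc p l} = q + 1"

definition incidence_matrix :: "('p::finite \<Rightarrow> 'l::finite \<Rightarrow> bool) \<Rightarrow> int^'l^'p" where
  "incidence_matrix inc = (\<chi> p l. if inc p l then 1 else 0)"


section \<open>Discretely valued fields with a coefficient field\<close>

text \<open>
  The value \<open>Pinf\<close> is taken at \<open>0\<close> only; \<open>Minf\<close>, which exists in the type, is excluded.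
  The last five assumptions say that \<open>k\<close> is a subfield of the valuation ring mapped bijectively
  (hence isomorphically) onto the residue field; the residue class of \<open>x\<close> is represented by
  the unique \<open>c \<in> k\<close> for which \<open>x - c\<close> lies in the maximal ideal.
\<close>

locale discretely_valued_field =
  fixes val :: "'a::field \<Rightarrow> int extended" and t :: 'a and k :: "'a set"
  assumes val_eq_Pinf_iff: "val x = Pinf \<longleftrightarrow> x = 0"
    and val_neq_Minf: "val x \<noteq> Minf"
    and val_mult: "val (x * y) = val x + val y"
    and val_add: "min (val x) (val y) \<le> val (x + y)"
    and val_uniformizer: "val t = Fin 1"
    and k_zero_one: "0 \<in> k" "1 \<in> k"
    and k_diff: "x \<in> k \<Longrightarrow> y \<in> k \<Longrightarrow> x - y \<in> k"
    and k_mult_inverse: "x \<in> k \<Longrightarrow> y \<in> k \<Longrightarrow> x * y \<in> k" "x \<in> k \<Longrightarrow> inverse x \<in> k"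
    and k_subset_val_ring: "x \<in> k \<Longrightarrow> Fin 0 \<le> val x"
    and k_residue: "Fin 0 \<le> val x \<Longrightarrow> \<exists>!c. c \<in> k \<and> Fin 0 < val (x - c)"


section \<open>Lifts and valuation patterns\<close>

definition rank_le3_lift ::
  "('a::field \<Rightarrow> int extended) \<Rightarrow> ('p::finite \<Rightarrow> 'l::finite \<Rightarrow> bool) \<Rightarrow> 'a^'l^'p \<Rightarrow> bool" where
  "rank_le3_lift val inc N \<longleftrightarrow>
     rank N \<le> 3 \<and> (\<forall>p l. val (N $ p $ l) = Fin (incidence_matrix inc $ p $ l))"

definition submatrix_of :: "'a^4^4 \<Rightarrow> 'a^'l^'p \<Rightarrow> bool" where
  "submatrix_of M N \<longleftrightarrow>
     (\<exists>r c. inj r \<and> inj c \<and> M = (\<chi> i j. N $ r i $ c j))"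

definition identity_valuation_pattern :: "('a::field \<Rightarrow> int extended) \<Rightarrow> 'a^4^4 \<Rightarrow> bool" where
  "identity_valuation_pattern val M \<longleftrightarrow>
     (\<forall>i j. val (M $ i $ j) = (if i = j then Fin 1 else Fin 0))"


section \<open>The polynomials \<open>\<Theta>\<^sub>4\<close> and \<open>\<Psi>\<^sub>4\<close>\<close>

text \<open>
  The index type \<open>4\<close> has the four elements \<open>1, 2, 3, 4\<close>, with arithmetic modulo 4. The families
  \<open>u\<close> and \<open>w\<close> are total functions, but their diagonal values are never used.
\<close>

definition derangements4 :: "(4 \<Rightarrow> 4) set" where
  "derangements4 = {\<sigma>. \<sigma> permutes UNIV \<and> (\<forall>i. \<sigma> i \<noteq> i)}"

definition Theta4 :: "(4 \<Rightarrow> 4 \<Rightarrow> 'a::field) \<Rightarrow> 'a" where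
  "Theta4 u = (\<Sum>\<sigma>\<in>derangements4. of_int (sign \<sigma>) * (\<Prod>r\<in>UNIV. u r (\<sigma> r)))"

text \<open>
  \<open>cycle_sum u i\<close> is the polynomial \<open>D\<^sub>i\<close> evaluated at \<open>u\<close>.
  The indices other than \<open>i\<close> are \<open>i + 1\<close>, \<open>i + 2\<close>, \<open>i + 3\<close> modulo 4. The lemma
  \<open>cycle_sum_eq\<close> shows that the order in which they are listed is irrelevant.
\<close>

definition cycle_sum :: "(4 \<Rightarrow> 4 \<Rightarrow> 'a::field) \<Rightarrow> 4 \<Rightarrow> 'a" where
  "cycle_sum u i = (let j = i + 1; k = i + 2; l = i + 3 in
     u j k * u k l * u l j + u j l * u l k * u k j)"

lemma UNIV_minus_4: "UNIV - {i} = {i + 1, i + 2, i + 3}" for i :: 4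
proof (rule card_subset_eq[symmetric])
  have d: "(1::4) \<noteq> 0" "(2::4) \<noteq> 0" "(3::4) \<noteq> 0" "(1::4) \<noteq> 2" "(1::4) \<noteq> 3" "(2::4) \<noteq> 3"
    by simp_all
  show "{i + 1, i + 2, i + 3} \<subseteq> UNIV - {i}" using d by auto
  show "card {i + 1, i + 2, i + 3} = card (UNIV - {i})" using d by (simp add: card_Diff_singleton)
qed simp

lemma cycle_sum_eq:
  fixes u :: "4 \<Rightarrow> 4 \<Rightarrow> 'a::field"
  assumes "{j, k, l} = UNIV - {i}"
  shows "cycle_sum u i = u j k * u k l * u l j + u j l * u l k * u k j"
proof -
  define x y z where xyz: "x = i + 1" "y = i + 2" "z = i + 3"
  have "card {j, k, l} = 3"
    unfolding assms by (simp add: card_Diff_singleton)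
  then have d: "j \<noteq> k" "j \<noteq> l" "k \<noteq> l"
    by (auto simp: card_insert_if split: if_splits)
  have e: "{j, k, l} = {x, y, z}"
    using assms UNIV_minus_4[of i] by (simp add: xyz)
  then have "j \<in> {x, y, z}" "k \<in> {x, y, z}" "l \<in> {x, y, z}"
    by auto
  then have "(j = x \<and> k = y \<and> l = z) \<or> (j = x \<and> k = z \<and> l = y) \<or> (j = y \<and> k = x \<and> l = z) \<or>
     (j = y \<and> k = z \<and> l = x) \<or> (j = z \<and> k = x \<and> l = y) \<or> (j = z \<and> k = y \<and> l = x)"
    using d by auto
  then have "u x y * u y z * u z x + u x z * u z y * u y x
      = u j k * u k l * u l j + u j l * u l k * u k j"
    by (elim disjE) (simp_all add: ac_simps)
  then show ?thesis
    by (simp add: cycle_sum_def Let_def xyz)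
qed

definition Psi4 :: "(4 \<Rightarrow> 4 \<Rightarrow> 'a::field) \<Rightarrow> (4 \<Rightarrow> 'a) \<Rightarrow> (4 \<Rightarrow> 4 \<Rightarrow> 'a) \<Rightarrow> 'a" where
  "Psi4 u a w =
     (\<Sum>i\<in>UNIV. a i * cycle_sum u i) +
     (\<Sum>\<sigma>\<in>derangements4. of_int (sign \<sigma>) * (\<Prod>r\<in>UNIV. u r (\<sigma> r)) *
        (\<Sum>r\<in>UNIV. w r (\<sigma> r) / u r (\<sigma> r)))"

end

theory Submission
  imports Defs
begin

text \<open>
  Writing the entries as \<open>m\<^sub>i\<^sub>j = x\<^sub>i\<^sub>j + t y\<^sub>i\<^sub>j + O(t\<^sup>2)\<close>, where \<open>x\<close> vanishes and \<open>y\<close> is \<open>a\<close> on the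
  diagonal, the Leibniz formula gives \<open>det M = \<Theta>\<^sub>4 + t \<Psi>\<^sub>4 + O(t\<^sup>2)\<close>: a permutation with one fixed
  point is a 3-cycle and contributes to \<open>a\<^sub>i D\<^sub>i\<close>, and one with more fixed points contributes nothing.
  Since \<open>det M = 0\<close> and nonzero elements of \<open>k\<close> have valuation \<open>0\<close>, both coefficients vanish.
\<close>

section \<open>Minors and rank\<close>

text \<open>Selecting coordinates along \<open>c\<close> is linear, so passing from \<open>N\<close>
  to chosen columns cannot raise the dimension of the row space.\<close>

lemma linear_vec_reindex:
  "Vector_Spaces.linear (*s) (*s) (\<lambda>x. (\<chi> j. x $ c j) :: 'a::field^'n)"
  by unfold_locales (simp_all add: vec_eq_iff)

text \<open>The rows of a nonsingular minor span the whole space, and each is the image of a row of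
  \<open>N\<close> under coordinate selection, a linear map.\<close>

lemma card_le_rank_if_minor_nonzero:
  fixes N :: "'a::field^'l^'p" and r :: "'n::finite \<Rightarrow> 'p::finite" and c :: "'n \<Rightarrow> 'l::finite"
  assumes "det (\<chi> i j. N $ r i $ c j) \<noteq> 0"
  shows "CARD('n) \<le> rank N"
proof -
  define M :: "'a^'n^'n" where "M = (\<chi> i j. N $ r i $ c j)"
  define f :: "'a^'l \<Rightarrow> 'a^'n" where "f = (\<lambda>x. \<chi> j. x $ c j)"
  have f: "Vector_Spaces.linear (*s) (*s) f"
    unfolding f_def by (rule linear_vec_reindex)
  have "vec.span (rows M) = UNIV"
    using assms unfolding M_def[symmetric] invertible_det_nz[symmetric] invertible_left_inverse
    by (simp add: matrix_left_invertible_span_rows_gen)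
  then have "CARD('n) = vec.dim (rows M)"
    by (metis vec.dim_span vec_dim_card)
  also have "\<dots> \<le> vec.dim (f ` rows N)"
  proof (rule vec.dim_subset)
    have "row i M = f (row (r i) N)" for i
      by (simp add: row_def M_def f_def vec_eq_iff)
    then show "rows M \<subseteq> f ` rows N"
      by (auto simp: rows_def)
  qed
  also have "\<dots> \<le> vec.dim (rows N)"
    by (rule vec.dim_image_le[OF f])
  finally show ?thesis
    by (simp add: row_rank_def_gen)
qed


section \<open>First-order expansion of a determinant\<close>

context discretely_valued_field
begin

section \<open>Valuation bounds and closure properties of the coefficient field\<close>

lemma val_ge_mult:
  assumes "Fin m \<le> val x" "Fin n \<le> val y"
  shows "Fin (m + n) \<le> val (x * y)"
  using add_mono[OF assms] by (simp add: val_mult)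

lemma val_ge_mono: "Fin n \<le> val x \<Longrightarrow> m \<le> n \<Longrightarrow> Fin m \<le> val x"
  by (rule order_trans[of _ "Fin n"]) auto

lemma val_ge_add: "Fin n \<le> val x \<Longrightarrow> Fin n \<le> val y \<Longrightarrow> Fin n \<le> val (x + y)"
  by (rule order_trans[OF _ val_add]) simp

lemma val_ge_zero: "Fin n \<le> val 0"
  using val_eq_Pinf_iff[of 0] by simp

lemma k_uminus: "x \<in> k \<Longrightarrow> - x \<in> k"
  using k_diff[OF k_zero_one(1)] by simp

lemma k_add: "x \<in> k \<Longrightarrow> y \<in> k \<Longrightarrow> x + y \<in> k"
  using k_diff[of x "- y"] k_uminus by simp

lemma k_divide: "x \<in> k \<Longrightarrow> y \<in> k \<Longrightarrow> x / y \<in> k"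
  by (simp add: divide_inverse k_mult_inverse)

lemma k_sum: "(\<And>i. i \<in> S \<Longrightarrow> f i \<in> k) \<Longrightarrow> sum f S \<in> k"
  by (induction S rule: infinite_finite_induct) (auto intro: k_zero_one k_add)

lemma k_prod: "(\<And>i. i \<in> S \<Longrightarrow> f i \<in> k) \<Longrightarrow> prod f S \<in> k"
  by (induction S rule: infinite_finite_induct) (auto intro: k_zero_one k_mult_inverse)

lemma k_sign: "of_int (sign \<sigma>) \<in> k"
  by (auto simp: sign_def intro: k_zero_one k_uminus)

text \<open>Since \<open>- 1\<close> lies in \<open>k\<close>, it has nonnegative valuation, and
  multiplying by it preserves lower bounds.\<close>

lemma val_ge_uminus: "Fin n \<le> val x \<Longrightarrow> Fin n \<le> val (- x)"
  using val_ge_mult[of 0 "- 1" n x] k_subset_val_ring[OF k_uminus[OF k_zero_one(2)]] by simp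

lemma val_ge_diff: "Fin n \<le> val x \<Longrightarrow> Fin n \<le> val y \<Longrightarrow> Fin n \<le> val (x - y)"
  using val_ge_add[of n x "- y"] val_ge_uminus by simp

lemma val_ge_sum: "(\<And>i. i \<in> S \<Longrightarrow> Fin n \<le> val (f i)) \<Longrightarrow> Fin n \<le> val (sum f S)"
  by (induction S rule: infinite_finite_induct) (auto intro: val_ge_zero val_ge_add)

lemma val_ge_prod: "(\<And>i. i \<in> S \<Longrightarrow> Fin 0 \<le> val (f i)) \<Longrightarrow> Fin 0 \<le> val (prod f S)"
proof (induction S rule: infinite_finite_induct)
  case (insert i S)
  then show ?case using val_ge_mult[of 0 "f i" 0 "prod f S"] by simp
qed (auto intro: k_subset_val_ring k_zero_one)

lemma val_ge_t_mult: "Fin n \<le> val x \<Longrightarrow> Fin (n + 1) \<le> val (t * x)"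
  using val_ge_mult[of 1 t n x] by (simp add: val_uniformizer add.commute)

lemma val_ge_t_mult_cancel: "Fin (n + 1) \<le> val (t * x) \<Longrightarrow> Fin n \<le> val x"
  by (cases "val x") (auto simp: val_mult val_uniformizer)

text \<open>A nonzero \<open>x\<close> has its inverse in \<open>k\<close>, of nonnegative
  valuation, so \<open>1 = x * inverse x\<close> would have positive valuation.\<close>

lemma k_eq_0_if_val_pos:
  assumes "x \<in> k" "Fin 1 \<le> val x"
  shows "x = 0"
proof (rule ccontr)
  assume "x \<noteq> 0"
  have "Fin 1 \<le> val 1"
    using val_ge_mult[OF assms(2), of 0 "inverse x"] k_subset_val_ring k_mult_inverse(2)[OF assms(1)]
      \<open>x \<noteq> 0\<close> by simp
  then show False
    \<comment> \<open>A finite value \<open>n\<close> of \<open>val 1\<close> satisfies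
      \<open>n = n + n\<close>, hence is 0; \<open>Pinf\<close> is excluded by
      \<open>1 \<noteq> 0\<close>.\<close>
    using val_mult[of 1 1] val_eq_Pinf_iff[of 1] by (cases "val 1") auto
qed

text \<open>Reduction modulo \<open>t\<close> kills \<open>x\<close>; then \<open>t\<close> can be
  cancelled from \<open>t * y\<close> and the same argument kills \<open>y\<close>.\<close>

lemma first_order_coeffs_eq_0:
  assumes "x \<in> k" "y \<in> k" "Fin 2 \<le> val (x + t * y)"
  shows "x = 0" "y = 0"
proof -
  have "Fin 1 \<le> val (t * y)"
    using val_ge_t_mult[OF k_subset_val_ring[OF assms(2)]] by simp
  with val_ge_mono[OF assms(3), of 1] have "Fin 1 \<le> val x"
    using val_ge_diff[of 1 "x + t * y" "t * y"] by simp
  then show "x = 0" by (rule k_eq_0_if_val_pos[OF assms(1)])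
  then show "y = 0"
    using assms val_ge_t_mult_cancel[of 1 y] k_eq_0_if_val_pos by simp
qed

text \<open>This is the product rule modulo \<open>t^2\<close>. The derivative omits the factor
  \<open>x r\<close> instead of dividing by it, because diagonal factors will be zero.\<close>

lemma prod_first_order:
  assumes "finite S"
    and "\<And>r. r \<in> S \<Longrightarrow> Fin 0 \<le> val (x r)" "\<And>r. r \<in> S \<Longrightarrow> Fin 0 \<le> val (y r)"
    and "\<And>r. r \<in> S \<Longrightarrow> Fin 2 \<le> val (m r - (x r + t * y r))"
  shows "Fin 2 \<le> val (prod m S - (prod x S + t * (\<Sum>r\<in>S. y r * prod x (S - {r}))))"
  using assms
proof (induction S rule: finite_induct)
  case empty
  then show ?case by (simp add: val_ge_zero)
next
  case (insert i S)
  define P where "P = (\<Sum>r\<in>S. y r * prod x (S - {r}))"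
  define Q where "Q = prod x S + t * P"
  define l where "l = x i + t * y i"
  have "Fin 0 \<le> val P"
    unfolding P_def using insert.prems
    by (auto intro!: val_ge_sum val_ge_mult[of 0 _ 0, simplified] val_ge_prod)
  moreover have "Fin 0 \<le> val (prod x S)"
    using insert.prems by (auto intro: val_ge_prod)
  moreover have "Fin 0 \<le> val (x i)" "Fin 0 \<le> val (y i)" and ml: "Fin 2 \<le> val (m i - l)"
    using insert.prems by (auto simp: l_def)
  moreover have "Fin 0 \<le> val (t * z)" if "Fin 0 \<le> val z" for z
    using val_ge_mono[OF val_ge_t_mult[OF that]] by simp
  ultimately have Q: "Fin 0 \<le> val Q" and l: "Fin 0 \<le> val l" and "Fin 0 \<le> val (y i * P)"
    using val_ge_mult[of 0 _ 0] by (auto simp: Q_def l_def intro!: val_ge_add)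
  from this(3) have e3: "Fin 2 \<le> val (t * (t * (y i * P)))"
    using val_ge_t_mult[OF val_ge_t_mult, of 0] by simp
  have m: "Fin 0 \<le> val (m i)"
    using val_ge_add[OF val_ge_mono[OF ml, of 0] l] by simp
  have "Fin 2 \<le> val (prod m S - Q)"
    using insert.IH insert.prems by (simp add: Q_def P_def)
  then have e1: "Fin 2 \<le> val (m i * (prod m S - Q))"
    using val_ge_mult[OF m] by fastforce
  have e2: "Fin 2 \<le> val ((m i - l) * Q)"
    using val_ge_mult[OF ml Q] by simp
  have "(\<Sum>r\<in>S. y r * prod x (insert i S - {r})) = x i * P"
    unfolding P_def sum_distrib_left
  proof (rule sum.cong)
    fix r assume "r \<in> S"
    then have "insert i S - {r} = insert i (S - {r})" "i \<notin> S - {r}"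
      using insert.hyps by auto
    then show "y r * prod x (insert i S - {r}) = x i * (y r * prod x (S - {r}))"
      using insert.hyps by (simp add: ac_simps)
  qed simp
  \<comment> \<open>The error telescopes: replace \<open>prod m S\<close> by \<open>Q\<close>, then
    \<open>m i\<close> by \<open>l\<close>; the last summand is the second-order part of
    \<open>l * Q\<close>.\<close>
  then have "prod m (insert i S) - (prod x (insert i S)
      + t * (\<Sum>r\<in>insert i S. y r * prod x (insert i S - {r})))
    = m i * (prod m S - Q) + (m i - l) * Q + t * (t * (y i * P))"
    using insert.hyps by (simp add: Q_def l_def algebra_simps)
  then show ?case
    using val_ge_add[OF val_ge_add[OF e1 e2] e3] by simp
qed

text \<open>The product rule applies to each term of the Leibniz formula; signs lie in
  \<open>k\<close>, so they do not weaken the bounds.\<close>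

lemma det_first_order:
  fixes M :: "'a^'n^'n"
  assumes "\<And>i j. Fin 0 \<le> val (x i j)" "\<And>i j. Fin 0 \<le> val (y i j)"
    and "\<And>i j. Fin 2 \<le> val (M $ i $ j - (x i j + t * y i j))"
  shows "Fin 2 \<le> val (det M -
    ((\<Sum>\<sigma> | \<sigma> permutes UNIV. of_int (sign \<sigma>) * (\<Prod>r\<in>UNIV. x r (\<sigma> r))) +
     t * (\<Sum>\<sigma> | \<sigma> permutes UNIV. of_int (sign \<sigma>) *
       (\<Sum>r\<in>UNIV. y r (\<sigma> r) * (\<Prod>s\<in>UNIV - {r}. x s (\<sigma> s))))))"
proof -
  have "Fin 2 \<le> val (of_int (sign \<sigma>) * ((\<Prod>r\<in>UNIV. M $ r $ \<sigma> r) - ((\<Prod>r\<in>UNIV. x r (\<sigma> r)) +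
      t * (\<Sum>r\<in>UNIV. y r (\<sigma> r) * (\<Prod>s\<in>UNIV - {r}. x s (\<sigma> s))))))" for \<sigma> :: "'n \<Rightarrow> 'n"
    using val_ge_mult[OF k_subset_val_ring[OF k_sign] prod_first_order[of UNIV "\<lambda>r. x r (\<sigma> r)"
        "\<lambda>r. y r (\<sigma> r)" "\<lambda>r. M $ r $ \<sigma> r"]] assms by simp
  from val_ge_sum[OF this] show ?thesis
    unfolding det_def
    by (simp add: sum_subtractf sum.distrib sum_distrib_left right_diff_distrib distrib_left
        mult.left_commute)
qed

section \<open>Membership of the two coefficients in the coefficient field\<close>

lemma Theta4_in_k:
  assumes "\<And>i j. i \<noteq> j \<Longrightarrow> u i j \<in> k"
  shows "Theta4 u \<in> k"
  unfolding Theta4_def using assms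
  by (intro k_sum k_mult_inverse(1) k_sign k_prod) (simp add: derangements4_def neq_commute)

lemma Psi4_in_k:
  assumes "\<And>i j. i \<noteq> j \<Longrightarrow> u i j \<in> k" "\<And>i. a i \<in> k" "\<And>i j. i \<noteq> j \<Longrightarrow> w i j \<in> k"
  shows "Psi4 u a w \<in> k"
  unfolding Psi4_def cycle_sum_def Let_def
  \<comment> \<open>What remains are inequalities of indices: \<open>i + 1\<close>,
    \<open>i + 2\<close>, \<open>i + 3\<close> are distinct modulo 4, and a derangement moves every
    index.\<close>
  by (intro k_add k_sum k_mult_inverse(1) k_sign k_prod k_divide assms)
    (simp_all add: derangements4_def neq_commute)

end


section \<open>Permutations of four points\<close>

text \<open>A fixed point of the permutation puts a zero diagonal entry into the product.\<close>

lemma sum_over_derangements4: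
  fixes x :: "4 \<Rightarrow> 4 \<Rightarrow> 'a::field"
  assumes "\<And>i. x i i = 0" "\<And>i j. i \<noteq> j \<Longrightarrow> x i j = u i j"
  shows "(\<Sum>\<sigma> | \<sigma> permutes UNIV. of_int (sign \<sigma>) * (\<Prod>r\<in>UNIV. x r (\<sigma> r))) = Theta4 u"
  unfolding Theta4_def
proof (rule sum.mono_neutral_cong_right)
  show "\<forall>\<sigma>\<in>{\<sigma>. \<sigma> permutes UNIV} - derangements4.
      of_int (sign \<sigma>) * (\<Prod>r\<in>UNIV. x r (\<sigma> r)) = 0"
  proof
    fix \<sigma> :: "4 \<Rightarrow> 4"
    assume "\<sigma> \<in> {\<sigma>. \<sigma> permutes UNIV} - derangements4"
    then obtain i where "\<sigma> i = i" by (auto simp: derangements4_def)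
    then have "x i (\<sigma> i) = 0" using assms(1) by simp
    then have "(\<Prod>r\<in>UNIV. x r (\<sigma> r)) = 0" by (intro prod_zero) auto
    then show "of_int (sign \<sigma>) * (\<Prod>r\<in>UNIV. x r (\<sigma> r)) = 0" by simp
  qed
next
  fix \<sigma> assume "\<sigma> \<in> derangements4"
  then have "\<sigma> r \<noteq> r" for r by (simp add: derangements4_def)
  then have "x r (\<sigma> r) = u r (\<sigma> r)" for r using assms(2) by metis
  then show "of_int (sign \<sigma>) * (\<Prod>r\<in>UNIV. x r (\<sigma> r)) = of_int (sign \<sigma>) * (\<Prod>r\<in>UNIV. u r (\<sigma> r))"
    by simp
qed (auto simp: derangements4_def finite_permutations)

text \<open>On the other three points \<open>\<sigma>\<close> is a derangement, hence one of the two
  3-cycles: the choice of \<open>\<sigma> j\<close> determines the rest. Writing them as products of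
  transpositions makes their signs computable.\<close>

lemma permutes_4_one_fixed_point:
  fixes \<sigma> :: "4 \<Rightarrow> 4"
  assumes "\<sigma> permutes UNIV" "\<sigma> i = i" "\<And>s. s \<noteq> i \<Longrightarrow> \<sigma> s \<noteq> s" "UNIV - {i} = {j, l, m}"
  shows "\<sigma> = Transposition.transpose j l \<circ> Transposition.transpose l m \<or>
    \<sigma> = Transposition.transpose l m \<circ> Transposition.transpose j l"
proof -
  have "card {j, l, m} = 3"
    unfolding assms(4)[symmetric] by (simp add: card_Diff_singleton)
  then have d: "j \<noteq> l" "j \<noteq> m" "l \<noteq> m"
    by (auto simp: card_insert_if split: if_splits)
  have ni: "i \<noteq> j" "i \<noteq> l" "i \<noteq> m" and all: "s = i \<or> s = j \<or> s = l \<or> s = m" for s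
    using assms(4) by blast+
  have inj: "\<sigma> s = \<sigma> s' \<longleftrightarrow> s = s'" for s s'
    using permutes_inj[OF assms(1)] by (auto dest: injD)
  have "(\<sigma> j = l \<and> \<sigma> l = m \<and> \<sigma> m = j) \<or> (\<sigma> j = m \<and> \<sigma> l = j \<and> \<sigma> m = l)"
    using d ni all[of "\<sigma> j"] all[of "\<sigma> l"] all[of "\<sigma> m"] inj assms(2,3) by metis
  then show ?thesis
  proof (elim disjE conjE)
    assume "\<sigma> j = l" "\<sigma> l = m" "\<sigma> m = j"
    then have "\<sigma> s = (Transposition.transpose j l \<circ> Transposition.transpose l m) s" for s
      using all[of s] d ni assms(2) by (auto simp: Transposition.transpose_def)
    then show ?thesis by blast
  next
    assume "\<sigma> j = m" "\<sigma> l = j" "\<sigma> m = l"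
    then have "\<sigma> s = (Transposition.transpose l m \<circ> Transposition.transpose j l) s" for s
      using all[of s] d ni assms(2) by (auto simp: Transposition.transpose_def)
    then show ?thesis by blast
  qed
qed

text \<open>Here row \<open>i\<close> is the differentiated one. A fixed point other than
  \<open>i\<close> contributes a zero factor, so only the two 3-cycles fixing \<open>i\<close>
  survive, and they give the two monomials of \<open>cycle_sum u i\<close>.\<close>

lemma sum_over_nonderangements4:
  fixes x y :: "4 \<Rightarrow> 4 \<Rightarrow> 'a::field"
  assumes "\<And>i. x i i = 0" "\<And>i j. i \<noteq> j \<Longrightarrow> x i j = u i j"
  shows "(\<Sum>\<sigma> | \<sigma> permutes UNIV \<and> \<sigma> \<notin> derangements4.
    of_int (sign \<sigma>) * (y i (\<sigma> i) * (\<Prod>s\<in>UNIV - {i}. x s (\<sigma> s)))) = y i i * cycle_sum u i"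
    (is "sum ?f ?N = _")
proof -
  define j l m where jlm: "j = i + 1" "l = i + 2" "m = i + 3"
  have U: "UNIV - {i} = {j, l, m}"
    unfolding jlm by (rule UNIV_minus_4)
  have d: "j \<noteq> l" "j \<noteq> m" "l \<noteq> m"
    by (simp_all add: jlm)
  have ni: "i \<noteq> j" "i \<noteq> l" "i \<noteq> m"
    using U by blast+
  define p q where
    pq: "p = Transposition.transpose j l \<circ> Transposition.transpose l m"
      "q = Transposition.transpose l m \<circ> Transposition.transpose j l"
  have p: "p i = i" "p j = l" "p l = m" "p m = j" and q: "q i = i" "q j = m" "q l = j" "q m = l"
    using d ni by (auto simp: pq Transposition.transpose_def)
  have perm: "p permutes UNIV" "q permutes UNIV"
    unfolding pq by (intro permutes_compose permutes_swap_id UNIV_I)+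
  \<comment> \<open>Both 3-cycles are even, which is why \<open>cycle_sum\<close> carries no
    signs.\<close>
  have sgn: "sign p = 1" "sign q = 1"
    using d by (simp_all add: pq sign_compose permutation_swap_id sign_swap_id)
  have "p \<noteq> q" using p q d by metis
  have "sum ?f ?N = sum ?f {p, q}"
  proof (rule sum.mono_neutral_right)
    show "finite ?N" by (rule finite_subset[OF _ finite_permutations[of UNIV]]) auto
    show "{p, q} \<subseteq> ?N" using perm p(1) q(1) by (auto simp: derangements4_def)
    show "\<forall>\<sigma>\<in>?N - {p, q}. ?f \<sigma> = 0"
    proof
      fix \<sigma> assume \<sigma>: "\<sigma> \<in> ?N - {p, q}"
      \<comment> \<open>Otherwise \<open>i\<close> would be the only fixed point, and
        \<open>\<sigma>\<close> would be \<open>p\<close> or \<open>q\<close>.\<close>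
      have "\<exists>s. s \<noteq> i \<and> \<sigma> s = s"
      proof (rule ccontr)
        assume none: "\<not> (\<exists>s. s \<noteq> i \<and> \<sigma> s = s)"
        with \<sigma> have "\<sigma> i = i" by (auto simp: derangements4_def)
        then show False
          using permutes_4_one_fixed_point[OF _ _ _ U, of \<sigma>] none \<sigma> by (auto simp: pq)
      qed
      then have "(\<Prod>s\<in>UNIV - {i}. x s (\<sigma> s)) = 0"
        using assms(1) by (intro prod_zero) (auto intro!: bexI)
      then show "?f \<sigma> = 0" by simp
    qed
  qed
  also have "\<dots> = y i i * (x j l * x l m * x m j + x j m * x m l * x l j)"
    using \<open>p \<noteq> q\<close> d by (simp add: U sgn p q algebra_simps)
  also have "\<dots> = y i i * cycle_sum u i"
    using d d[symmetric] by (simp add: cycle_sum_eq[OF U[symmetric]] assms(2))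
  finally show ?thesis .
qed

text \<open>Splitting the permutations by whether they have a fixed point produces the two sums that
  define \<open>Psi4\<close>.\<close>

lemma first_order_sum_eq_Psi4:
  fixes x y :: "4 \<Rightarrow> 4 \<Rightarrow> 'a::field"
  assumes x: "\<And>i. x i i = 0" "\<And>i j. i \<noteq> j \<Longrightarrow> x i j = u i j"
    and y: "\<And>i. y i i = a i" "\<And>i j. i \<noteq> j \<Longrightarrow> y i j = w i j"
    and u: "\<And>i j. i \<noteq> j \<Longrightarrow> u i j \<noteq> 0"
  shows "(\<Sum>\<sigma> | \<sigma> permutes UNIV. of_int (sign \<sigma>) *
    (\<Sum>r\<in>UNIV. y r (\<sigma> r) * (\<Prod>s\<in>UNIV - {r}. x s (\<sigma> s)))) = Psi4 u a w"
    (is "sum ?f _ = _")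
proof -
  let ?N = "{\<sigma>. \<sigma> permutes UNIV \<and> \<sigma> \<notin> derangements4}"
  have "sum ?f {\<sigma>. \<sigma> permutes UNIV} = sum ?f ?N + sum ?f derangements4"
    by (subst sum.union_disjoint[symmetric])
      (auto intro!: sum.cong finite_subset[OF _ finite_permutations[of UNIV]]
        simp: derangements4_def)
  \<comment> \<open>Exchanging the sums fixes the differentiated row before summing over
    permutations.\<close>
  also have "sum ?f ?N = (\<Sum>i\<in>UNIV. a i * cycle_sum u i)"
    unfolding sum_distrib_left using sum_over_nonderangements4[of x u y] x y(1)
    by (subst sum.swap) simp
  also have "sum ?f derangements4 =
    (\<Sum>\<sigma>\<in>derangements4. of_int (sign \<sigma>) * (\<Prod>r\<in>UNIV. u r (\<sigma> r)) *
        (\<Sum>r\<in>UNIV. w r (\<sigma> r) / u r (\<sigma> r)))"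
  proof (rule sum.cong)
    fix \<sigma> assume "\<sigma> \<in> derangements4"
    then have "r \<noteq> \<sigma> r" for r by (simp add: derangements4_def eq_commute)
    then have *: "x r (\<sigma> r) = u r (\<sigma> r)" "y r (\<sigma> r) = w r (\<sigma> r)" "u r (\<sigma> r) \<noteq> 0" for r
      using x(2) y(2) u by blast+
    \<comment> \<open>Nonvanishing of the off-diagonal \<open>u\<close> turns omission of a factor
      into division, giving the logarithmic derivative in \<open>Psi4\<close>.\<close>
    have "(\<Prod>s\<in>UNIV - {r}. u s (\<sigma> s)) = (\<Prod>s\<in>UNIV. u s (\<sigma> s)) / u r (\<sigma> r)" for r
      using *(3) by (simp add: prod.remove[of UNIV r])
    then show "?f \<sigma> = of_int (sign \<sigma>) * (\<Prod>r\<in>UNIV. u r (\<sigma> r)) *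
        (\<Sum>r\<in>UNIV. w r (\<sigma> r) / u r (\<sigma> r))"
      by (simp add: *(1,2) sum_distrib_left mult.commute mult.left_commute)
  qed simp
  finally show ?thesis by (simp add: Psi4_def)
qed

section \<open>Vanishing of the determinant and of its first two coefficients\<close>

theorem corollary4p16:
  fixes inc :: "'p::finite \<Rightarrow> 'l::finite \<Rightarrow> bool"
    and val :: "'a::field \<Rightarrow> int extended" and t :: 'a and k :: "'a set"
    and N :: "'a^'l^'p" and M :: "'a^4^4"
    and a :: "4 \<Rightarrow> 'a" and u w :: "4 \<Rightarrow> 4 \<Rightarrow> 'a"
  assumes "projective_plane inc"
    and "discretely_valued_field val t k"
    and "rank_le3_lift val inc N"
    and "submatrix_of M N"
    and "identity_valuation_pattern val M"
    and "\<And>i. a i \<in> k - {0}"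
    and "\<And>i. Fin 2 \<le> val (M $ i $ i - t * a i)"
    and "\<And>i j. i \<noteq> j \<Longrightarrow> u i j \<in> k - {0}"
    and "\<And>i j. i \<noteq> j \<Longrightarrow> w i j \<in> k"
    and "\<And>i j. i \<noteq> j \<Longrightarrow> Fin 2 \<le> val (M $ i $ j - (u i j + t * w i j))"
  shows "det M = 0 \<and> Theta4 u = 0 \<and> Psi4 u a w = 0"
proof -
  interpret discretely_valued_field val t k by fact
  have "\<not> CARD(4) \<le> rank N"
    using \<open>rank_le3_lift val inc N\<close> by (simp add: rank_le3_lift_def)
  with \<open>submatrix_of M N\<close> have det: "det M = 0"
    unfolding submatrix_of_def using card_le_rank_if_minor_nonzero by blast
  \<comment> \<open>With these diagonal values the expansion \<open>t * a i\<close> takes the same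
    form \<open>x i j + t * y i j\<close> as the other entries.\<close>
  define x where "x = (\<lambda>i j. if i = j then 0 else u i j)"
  define y where "y = (\<lambda>i j. if i = j then a i else w i j)"
  have x: "x i i = 0" "i \<noteq> j \<Longrightarrow> x i j = u i j" and y: "y i i = a i" "i \<noteq> j \<Longrightarrow> y i j = w i j"
    for i j by (simp_all add: x_def y_def)
  have "x i j \<in> k" "y i j \<in> k" for i j
    using assms(6,8,9) k_zero_one(1) by (auto simp: x_def y_def)
  then have "Fin 0 \<le> val (x i j)" "Fin 0 \<le> val (y i j)" for i j
    by (auto intro: k_subset_val_ring)
  moreover have "Fin 2 \<le> val (M $ i $ j - (x i j + t * y i j))" for i j
    using assms(7,10) by (simp add: x_def y_def)
  ultimately have "Fin 2 \<le> val (det M - (Theta4 u + t * Psi4 u a w))"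
    using det_first_order[of x y M] assms(8)
    by (simp add: sum_over_derangements4[of x u] first_order_sum_eq_Psi4[of x u y a w] x y)
  \<comment> \<open>As \<open>det M = 0\<close>, the previous bound concerns the negative of this
    expression.\<close>
  then have val: "Fin 2 \<le> val (Theta4 u + t * Psi4 u a w)"
    using val_ge_uminus[of 2 "det M - (Theta4 u + t * Psi4 u a w)"] det by (simp add: add.commute)
  have "Theta4 u \<in> k" "Psi4 u a w \<in> k"
    using assms(6,8,9) by (auto intro!: Theta4_in_k Psi4_in_k)
  from first_order_coeffs_eq_0[OF this val] det show ?thesis
    by simp
qed

end
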